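(* Let $1\le n<m$ be integers. In nodal DGSEM-LGL (the discontinuous Galerkin spectral element method collocated at Legendre-Gauss-Lobatto nodes), the low-order components (Legendre modes of degree $\le n$) of a high-order (order-$m$) solution can be recovered exactly on the low-order (order-$n$) nodes if and only if the high-order flux vectors $\underline f^{(m)}:=f(\underline u^{(m)})$ are given. More explicitly, let the order-$m$ time derivative $\underline{\dot u}^{(m)}\in\mathbb R^{m+1}$ in an element be given by the DGSEM-LGL scheme of order $m$, $$\mathcal J_i\,\underline{\dot u}^{(m)}+\frac{f_L^{\ast(m)}-f_0^{(m)}}{\omega_0^{(m)}}\,\underline b_L^{(m)}+\frac{f_R^{\ast(m)}-f_m^{(m)}}{\omega_m^{(m)}}\,\underline b_R^{(m)}+D^{(m)}\underline f^{(m)}=0 .$$ Then the projected high-order time derivative $\overline{\underline{\dot u}^{(m)}}:=\Pi\,\underline{\dot u}^{(m)}\in\mathbb R^{n+1}$ is governed by the equation $$\begin{aligned}\mathcal J_i\,\overline{\underline{\dot u}^{(m)}}&+\frac{f_L^{\ast(m)}-\overline{f_0^{(m)}}}{\omega_0^{(n)}}\,\underline b_L^{(n)}+\frac{f_R^{\ast(m)}-\overline{f_n^{(m)}}}{\omega_n^{(n)}}\,\underline b_R^{(n)}+D^{(n)}\,\overline{\underline f^{(m)}}\\&+\frac{n+1}{2}\Big[\big(f_R^{\ast(m)}-\overline{f_n^{(m)}}\big)-(-1)^n\big(f_L^{\ast(m)}-\overline{f_0^{(m)}}\big)\Big]\underline v_n^{(n)}=0,\end{aligned}$$ where $\overline{\underline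 f^{(m)}}:=\Pi\,\underline f^{(m)}\in\mathbb R^{n+1}$ and $\overline{f_0^{(m)}},\overline{f_n^{(m)}}$ denote its first and last entries.
   Context: A scalar component $u$ of a one-dimensional conservation law $\partial_t u+\partial_x f(u)=0$ is discretized on a mesh of intervals, each mapped affinely from $[-1,1]$; $\mathcal J_i>0$ is the constant Jacobian of the map from $[-1,1]$ to the element considered. $\underline u^{(m)}\in\mathbb R^{m+1}$ is the vector of nodal values of the order-$m$ solution in the element, $\underline f^{(m)}=f(\underline u^{(m)})=[f_0^{(m)},\dots,f_m^{(m)}]^\top$ is the vector of nodal fluxes (the flux function $f$ applied to the nodal values), and $f_L^{\ast(m)},f_R^{\ast(m)}\in\mathbb R$ are the numerical fluxes at the left and right ends of the element, computed from the order-$m$ solution. Vector and matrix indices start at $0$. $L_k$ is the Legendre polynomial of degree $k$ normalized by $L_k(1)=1$. For $p\in\{n,m\}$: $-1=\xi_0^{(p)}<\dots<\xi_p^{(p)}=1$ are the $p+1$ Legendre-Gauss-Lobatto (LGL) nodes on $[-1,1]$ with quadrature weights $\omega_i^{(p)}=\frac{2}{p(p+1)L_p(\xi_i^{(p)})^2}$; $\ell_j^{(p)}$ are the Lagrange polynomials at these nodes; $D^{(p)}\in\mathbb R^{(p+1)\times(p+1)}$, $D^{(p)}_{ij}=(\ell_j^{(p)})'(\xi_i^{(p)})$, is the differentiation matrix; $V^{(p)}\in\mathbb R^{(p+1)\times(p+1)}$, $V^{(p)}_{ij}=L_j(\xi_i^{(p)})$, is the Legendre Vandermonde matrix; $\underline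 v_n^{(n)}=[L_n(\xi_0^{(n)}),\dots,L_n(\xi_n^{(n)})]^\top$ is the last column of $V^{(n)}$; $\underline b_L^{(p)}=[-1,0,\dots,0]^\top$ and $\underline b_R^{(p)}=[0,\dots,0,1]^\top$ in $\mathbb R^{p+1}$. The projection matrix is $\Pi:=V^{(n)}\,\overline{[V^{(m)}]^{-1}}\in\mathbb R^{(n+1)\times(m+1)}$, where $\overline{[V^{(m)}]^{-1}}$ consists of the first $n+1$ rows of $[V^{(m)}]^{-1}$. (Thus $\Pi$ takes nodal values of a degree-$m$ polynomial, truncates its Legendre expansion to degree $\le n$, and evaluates at the order-$n$ LGL nodes.) *)

theory Defs
  imports
    Complex_Main
    "HOL-Computational_Algebra.Polynomial"
    "Jordan_Normal_Form.Gauss_Jordan_Elimination"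
begin

text \<open>Rodrigues' formula; this is the normalization with value 1 at 1.\<close>
definition legendre :: "nat \<Rightarrow> real poly" where
  "legendre k = Polynomial.smult (1 / (2 ^ k * fact k)) ((pderiv ^^ k) ([:-1, 0, 1:] ^ k))"

text \<open>The Legendre-Gauss-Lobatto nodes of order \<open>p \<ge> 1\<close> are the \<open>p + 1\<close> zeros of
  \<open>(1 - x\<^sup>2) L\<^sub>p'(x)\<close>, that is, the two end points and the zeros of \<open>L\<^sub>p'\<close>, in increasing order.\<close>
definition lgl_node :: "nat \<Rightarrow> nat \<Rightarrow> real" where
  "lgl_node p i = sorted_list_of_set {x. poly ([:1, 0, -1:] * pderiv (legendre p)) x = 0} ! i"

definition lgl_weight :: "nat \<Rightarrow> nat \<Rightarrow> real" where
  "lgl_weight p i = 2 / (real p * (real p + 1) * (poly (legendre p) (lgl_node p i))\<^sup>2)"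

definition lagrange_poly :: "nat \<Rightarrow> nat \<Rightarrow> real poly" where
  "lagrange_poly p j =
     (\<Prod>k\<in>{..p} - {j}. Polynomial.smult (1 / (lgl_node p j - lgl_node p k)) [:- lgl_node p k, 1:])"

definition diff_mat :: "nat \<Rightarrow> real mat" where
  "diff_mat p = mat (p + 1) (p + 1) (\<lambda>(i, j). poly (pderiv (lagrange_poly p j)) (lgl_node p i))"

definition vandermonde :: "nat \<Rightarrow> real mat" where
  "vandermonde p = mat (p + 1) (p + 1) (\<lambda>(i, j). poly (legendre j) (lgl_node p i))"

definition b_left :: "nat \<Rightarrow> real vec" where
  "b_left p = - unit_vec (p + 1) 0"

definition b_right :: "nat \<Rightarrow> real vec" where
  "b_right p = unit_vec (p + 1) p"

text \<open>The right factor consists of the first \<open>n + 1\<close> rows of the inverse of \<open>vandermonde m\<close>.\<close>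
definition proj_mat :: "nat \<Rightarrow> nat \<Rightarrow> real mat" where
  "proj_mat n m = vandermonde n *
     mat (n + 1) (m + 1) (\<lambda>(i, j). the (mat_inverse (vandermonde m)) $$ (i, j))"

text \<open>\<open>dgsem_lgl m J fL fR g du\<close>: in an element with Jacobian \<open>J\<close> and numerical fluxes
  \<open>fL\<close>, \<open>fR\<close>, the order-\<open>m\<close> scheme with nodal flux vector \<open>g\<close> has time derivative \<open>du\<close>.\<close>
definition dgsem_lgl ::
  "nat \<Rightarrow> real \<Rightarrow> real \<Rightarrow> real \<Rightarrow> real vec \<Rightarrow> real vec \<Rightarrow> bool" where
  "dgsem_lgl m J fL fR g du \<longleftrightarrow>
     J \<cdot>\<^sub>v du
     + ((fL - g $ 0) / lgl_weight m 0) \<cdot>\<^sub>v b_left m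
     + ((fR - g $ m) / lgl_weight m m) \<cdot>\<^sub>v b_right m
     + diff_mat m *\<^sub>v g = 0\<^sub>v (m + 1)"

text \<open>\<open>recoverable_from n m info\<close>: some map computes the projected order-\<open>m\<close> time derivative, for
  every flux function \<open>f\<close> and every order-\<open>m\<close> solution \<open>u\<close>, from the element data \<open>J\<close>, \<open>fL\<close>, \<open>fR\<close>
  and the information \<open>info f u\<close>.\<close>
definition recoverable_from ::
  "nat \<Rightarrow> nat \<Rightarrow> ((real \<Rightarrow> real) \<Rightarrow> real vec \<Rightarrow> 'a) \<Rightarrow> bool" where
  "recoverable_from n m info \<longleftrightarrow>
     (\<exists>R :: real \<Rightarrow> real \<Rightarrow> real \<Rightarrow> 'a \<Rightarrow> real vec.
        \<forall>f J fL fR. \<forall>u \<in> carrier_vec (m + 1). \<forall>du \<in> carrier_vec (m + 1).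
          0 < J \<longrightarrow> dgsem_lgl m J fL fR (map_vec f u) du \<longrightarrow>
          proj_mat n m *\<^sub>v du = R J fL fR (info f u))"

end

theory Submission
  imports Defs "Jordan_Normal_Form.Determinant"
begin

text \<open>
  Let \<open>\<Delta>\<^sub>R\<close>, \<open>\<Delta>\<^sub>L\<close> be the sums of \<open>(2k+1)/2 L\<^sub>k\<close> and \<open>(2k+1)/2 (-1)\<^sup>k L\<^sub>k\<close> over \<open>k \<le> p\<close>. The classical
  derivative recurrences give \<open>\<Delta>\<^sub>R = (1+x) L\<^sub>p'/2 + (p+1)/2 L\<^sub>p\<close> and a mirror formula for \<open>\<Delta>\<^sub>L\<close>. As
  \<open>(1+x) L\<^sub>p'\<close> vanishes at every LGL node except \<open>1\<close>, the lifting term \<open>b\<^sub>R/\<omega>\<^sub>p\<close> is the nodal vector of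
  \<open>\<Delta>\<^sub>R - (p+1)/2 L\<^sub>p\<close>; no quadrature is involved. For \<open>p = m\<close> its truncation to degree \<open>n < m\<close> is the
  \<open>\<Delta>\<^sub>R\<close> of order \<open>n\<close>, which differs from the lifting term of order \<open>n\<close> by \<open>(n+1)/2 L\<^sub>n\<close>. Differentiation
  fails to commute with the truncation \<open>F \<mapsto> G\<close> only by \<open>(F(1)-G(1)) \<Delta>\<^sub>R - (F(-1)-G(-1)) \<Delta>\<^sub>L\<close>, which replaces
  the boundary values of \<open>F\<close> by those of \<open>G\<close> in the projected scheme.
\<close>

subsection \<open>Legendre polynomials\<close>

lemma poly_ext:
  fixes p q :: "real poly"
  assumes "\<And>x. poly p x = poly q x"
  shows "p = q"
  using assms by (simp flip: poly_eq_poly_eq_iff add: fun_eq_iff)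

text \<open>Leibniz' rule for a product with \<open>x\<close>: the second derivative of
  \<open>x\<close> is zero, so only two terms survive.\<close>

lemma higher_pderiv_x_mult:
  fixes p :: "real poly"
  shows "(pderiv ^^ Suc k) ([:0, 1:] * p)
    = [:0, 1:] * (pderiv ^^ Suc k) p + Polynomial.smult (real (Suc k)) ((pderiv ^^ k) p)"
proof (induction k)
  case 0
  then show ?case by (simp add: pderiv_mult pderiv_pCons)
next
  case (Suc k)
  show ?case
    unfolding funpow.simps(2)[of "Suc k"] o_apply Suc
    by (rule poly_ext) (simp add: pderiv_add pderiv_mult pderiv_smult pderiv_pCons algebra_simps)
qed

lemma pderiv_rodrigues_base:
  "pderiv ([:-1, 0, 1:] ^ Suc k) = Polynomial.smult (2 * real (Suc k)) ([:0, 1:] * [:-1, 0, 1:] ^ k)"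
  by (simp only: pderiv_power_Suc) (simp add: pderiv_pCons algebra_simps)

text \<open>One derivative of \<open>(x^2 - 1)^(k+1)\<close> yields the factor
  \<open>2 (k+1) x\<close>. Its constant absorbs the change of normalization, and Leibniz' rule then
  moves \<open>x\<close> to the front.\<close>

lemma pderiv_legendre_Suc:
  "pderiv (legendre (Suc k)) = [:0, 1:] * pderiv (legendre k) + Polynomial.smult (real (Suc k)) (legendre k)"
proof -
  have "pderiv (legendre (Suc k)) = Polynomial.smult (1 / (2 ^ Suc k * fact (Suc k)))
      ((pderiv ^^ Suc k) (pderiv ([:-1, 0, 1:] ^ Suc k)))"
    by (simp add: legendre_def pderiv_smult funpow_swap1 del: power_Suc)
  also have "\<dots> = Polynomial.smult (1 / (2 ^ k * fact k)) ((pderiv ^^ Suc k) ([:0, 1:] * [:-1, 0, 1:] ^ k))"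
    unfolding pderiv_rodrigues_base higher_pderiv_smult smult_smult
    by (intro arg_cong2[where f = Polynomial.smult] refl) (simp add: divide_simps)
  finally show ?thesis
    unfolding higher_pderiv_x_mult by (simp add: legendre_def pderiv_smult smult_add_right mult.commute)
qed

text \<open>Two derivatives of \<open>w^(k+2)\<close>, with \<open>w = x^2 - 1\<close>, form a
  combination of \<open>w^(k+1)\<close> and \<open>w^k\<close>; the remaining \<open>k+1\<close>
  derivatives turn these into multiples of \<open>L_(k+1)\<close> and \<open>L_k'\<close>.\<close>

lemma pderiv_legendre_Suc_Suc:
  "pderiv (legendre (Suc (Suc k))) = pderiv (legendre k) + Polynomial.smult (2 * real k + 3) (legendre (Suc k))"
proof -
  let ?w = "[:-1, 0, 1:] :: real poly"
  let ?N = "2 * real (Suc (Suc k))"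
  \<comment> \<open>Writing \<open>x^2\<close> as \<open>w + 1\<close> leaves only powers of
    \<open>w\<close>.\<close>
  have x2: "[:0, 1:] * ([:0, 1:] * ?w ^ k) = ?w ^ Suc k + ?w ^ k"
  proof -
    have "[:0, 1:] * ([:0, 1:] * ?w ^ k) = ([:0, 1:] * [:0, 1:]) * ?w ^ k" by (simp only: mult.assoc)
    also have "[:0, 1:] * [:0, 1:] = ?w + 1" by (simp add: one_pCons)
    finally show ?thesis by (simp add: algebra_simps)
  qed
  have "pderiv (pderiv (?w ^ Suc (Suc k)))
     = Polynomial.smult ?N (pderiv ([:0, 1:] * ?w ^ Suc k))"
    unfolding pderiv_rodrigues_base pderiv_smult ..
  also have "pderiv ([:0, 1:] * ?w ^ Suc k)
     = ?w ^ Suc k + Polynomial.smult (2 * real (Suc k)) ([:0, 1:] * ([:0, 1:] * ?w ^ k))"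
    unfolding pderiv_mult[of "[:0, 1:]"] pderiv_rodrigues_base by (simp add: pderiv_pCons)
  also have "\<dots> = Polynomial.smult (2 * real k + 3) (?w ^ Suc k) + Polynomial.smult (2 * real (Suc k)) (?w ^ k)"
    unfolding x2 by (rule poly_ext) (simp add: algebra_simps del: power_Suc)
  finally have w: "pderiv (pderiv (?w ^ Suc (Suc k))) = Polynomial.smult (?N * (2 * real k + 3)) (?w ^ Suc k)
      + Polynomial.smult (?N * (2 * real (Suc k))) (?w ^ k)"
    by (simp only: smult_add_right smult_smult)
  have "pderiv (legendre (Suc (Suc k))) = Polynomial.smult (1 / (2 ^ Suc (Suc k) * fact (Suc (Suc k))))
      ((pderiv ^^ Suc k) (pderiv (pderiv (?w ^ Suc (Suc k)))))"
    by (simp add: legendre_def pderiv_smult funpow_swap1 del: power_Suc)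
  also have "\<dots> = Polynomial.smult ((2 * real k + 3) * (1 / (2 ^ Suc k * fact (Suc k)))) ((pderiv ^^ Suc k) (?w ^ Suc k))
      + Polynomial.smult (1 / (2 ^ k * fact k)) ((pderiv ^^ Suc k) (?w ^ k))"
    unfolding w higher_pderiv_smult higher_pderiv_add smult_smult smult_add_right
    by (intro arg_cong2[where f = "(+)"] arg_cong2[where f = Polynomial.smult] refl)
      (simp_all add: divide_simps, simp_all add: algebra_simps)
  also have "\<dots> = pderiv (legendre k) + Polynomial.smult (2 * real k + 3) (legendre (Suc k))"
    unfolding legendre_def pderiv_smult smult_smult by simp
  finally show ?thesis .
qed

section \<open>End-point values, simple zeros and telescoping sums\<close>

lemma legendre_0: "legendre 0 = 1"
  by (simp add: legendre_def)

lemma pderiv_legendre_1: "pderiv (legendre (Suc 0)) = 1"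
  by (simp add: pderiv_legendre_Suc legendre_0)

text \<open>Eliminating \<open>L_(k+2)'\<close> from the two recurrences. Together with
  \<open>pderiv_legendre_Suc\<close> this determines the pair \<open>L_(k+1)\<close>,
  \<open>L_(k+1)'\<close> at a point from the pair \<open>L_k\<close>, \<open>L_k'\<close>, which
  drives the inductions below.\<close>

lemma smult_legendre_Suc:
  "Polynomial.smult (real (Suc k)) (legendre (Suc k)) = [:0, 1:] * pderiv (legendre (Suc k)) - pderiv (legendre k)"
proof -
  have "[:0, 1:] * pderiv (legendre (Suc k)) + Polynomial.smult (real (Suc (Suc k))) (legendre (Suc k))
    = pderiv (legendre k) + Polynomial.smult (2 * real k + 3) (legendre (Suc k))"
    using pderiv_legendre_Suc[of "Suc k"] pderiv_legendre_Suc_Suc[of k] by simp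
  moreover have "Polynomial.smult (2 * real k + 3) (legendre (Suc k)) =
     Polynomial.smult (real (Suc (Suc k))) (legendre (Suc k)) + Polynomial.smult (real (Suc k)) (legendre (Suc k))"
    by (rule poly_ext) (simp add: algebra_simps)
  ultimately show ?thesis by (simp add: algebra_simps)
qed

lemma poly_pderiv_legendre_Suc:
  "poly (pderiv (legendre (Suc k))) x = x * poly (pderiv (legendre k)) x + real (Suc k) * poly (legendre k) x"
  by (simp add: pderiv_legendre_Suc)

lemma poly_smult_legendre_Suc:
  "real (Suc k) * poly (legendre (Suc k)) x = x * poly (pderiv (legendre (Suc k))) x - poly (pderiv (legendre k)) x"
  using arg_cong[OF smult_legendre_Suc, of "\<lambda>p. poly p x" k] by simp

text \<open>Where \<open>x^2 = 1\<close> the derivatives cancel from the two recurrences and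
  \<open>L_(k+1)(x) = x L_k(x)\<close> remains.\<close>

lemma legendre_at_1: "poly (legendre k) 1 = 1"
proof (induction k)
  case (Suc k)
  show ?case using poly_pderiv_legendre_Suc[of k 1] poly_smult_legendre_Suc[of k 1] Suc by auto
qed (simp add: legendre_0)

lemma legendre_at_minus_1: "poly (legendre k) (-1) = (-1) ^ k"
proof (induction k)
  case (Suc k)
  have "real (Suc k) * poly (legendre (Suc k)) (-1) = - (real (Suc k) * (-1) ^ k)"
    using poly_pderiv_legendre_Suc[of k "-1"] poly_smult_legendre_Suc[of k "-1"] unfolding Suc by linarith
  then have "real (Suc k) * poly (legendre (Suc k)) (-1) = real (Suc k) * (-1) ^ Suc k"
    by simp
  then show ?case by (simp only: mult_cancel_left of_nat_eq_0_iff nat.simps) simp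
qed (simp add: legendre_0)

text \<open>Descent: a common zero of \<open>L_(k+1)\<close> and \<open>L_(k+1)'\<close> is by the
  recurrences one of \<open>L_k'\<close> and then of \<open>L_k\<close>, but
  \<open>L_0 = 1\<close>.\<close>

lemma legendre_no_double_root:
  "\<not> (poly (legendre k) x = 0 \<and> poly (pderiv (legendre k)) x = 0)"
proof (induction k)
  case (Suc k)
  show ?case
    using Suc poly_pderiv_legendre_Suc[of k x] poly_smult_legendre_Suc[of k x] by auto
qed (simp add: legendre_0)

lemma degree_higher_pderiv: "degree ((pderiv ^^ k) (p :: real poly)) = degree p - k"
  by (induction k) (simp_all add: degree_pderiv)

lemma degree_legendre: "degree (legendre k) = k"
  by (simp add: legendre_def degree_higher_pderiv degree_power_eq)

lemma legendre_nonzero: "legendre k \<noteq> 0"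
  using legendre_at_1[of k] by auto

text \<open>\<open>(2k+3) L_(k+1) = L_(k+2)' - L_k'\<close> telescopes with stride two, so two
  derivatives are left over.\<close>

lemma sum_legendre:
  "(\<Sum>k\<le>n. Polynomial.smult (2 * real k + 1) (legendre k))
    = pderiv (legendre (Suc n)) + pderiv (legendre n)"
proof (induction n)
  case (Suc n)
  then show ?case by (simp add: pderiv_legendre_Suc_Suc[of n] algebra_simps)
qed (simp add: legendre_0 pderiv_legendre_1)

lemma alternating_sum_legendre:
  "(\<Sum>k\<le>n. Polynomial.smult ((2 * real k + 1) * (-1) ^ k) (legendre k))
    = Polynomial.smult ((-1) ^ n) (pderiv (legendre (Suc n)) - pderiv (legendre n))"
proof (induction n)
  case (Suc n)
  then show ?case
    by (simp add: pderiv_legendre_Suc_Suc[of n] smult_add_right smult_diff_right algebra_simps)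
qed (simp add: legendre_0 pderiv_legendre_1)

subsection \<open>LGL nodes\<close>

lemma pderiv_power_dvd:
  fixes p q :: "real poly"
  assumes "q ^ Suc a dvd p"
  shows "q ^ a dvd pderiv p"
proof -
  obtain r where "p = q ^ Suc a * r" using assms by (elim dvdE)
  then have "pderiv p = q ^ a * (q * pderiv r + Polynomial.smult (real (Suc a)) (pderiv q * r))"
    by (simp only: pderiv_mult pderiv_power_Suc) (simp add: algebra_simps)
  then show ?thesis by simp
qed

lemma power_dvd_higher_pderiv:
  fixes q :: "real poly"
  shows "j \<le> k \<Longrightarrow> q ^ (k - j) dvd (pderiv ^^ j) (q ^ k)"
proof (induction j)
  case (Suc j)
  then have "q ^ Suc (k - Suc j) dvd (pderiv ^^ j) (q ^ k)"
    by (simp add: Suc_diff_Suc del: power_Suc)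
  then show ?case using pderiv_power_dvd by simp
qed simp

lemma Rolle_roots:
  fixes p :: "real poly"
  assumes "\<And>i. i < s \<Longrightarrow> x i < x (Suc i)" and "\<And>i. i \<le> s \<Longrightarrow> poly p (x i) = 0"
  obtains y where "\<And>i. i < s \<Longrightarrow> x i < y i" "\<And>i. i < s \<Longrightarrow> y i < x (Suc i)"
    "\<And>i. i < s \<Longrightarrow> poly (pderiv p) (y i) = 0"
proof -
  have "\<forall>i. \<exists>y. i < s \<longrightarrow> x i < y \<and> y < x (Suc i) \<and> poly (pderiv p) y = 0"
  proof
    fix i
    show "\<exists>y. i < s \<longrightarrow> x i < y \<and> y < x (Suc i) \<and> poly (pderiv p) y = 0"
    proof (cases "i < s")
      case True
      then show ?thesis
        using poly_MVT[of "x i" "x (Suc i)" p] assms(1)[of i] assms(2)[of i] assms(2)[of "Suc i"] by auto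
    qed simp
  qed
  then show ?thesis using that by metis
qed

text \<open>Keeping both outer points makes the list one longer after each derivative. Whether they
  are zeros of the derivative is left to the caller.\<close>

lemma Rolle_roots_endpoints:
  fixes p :: "real poly"
  assumes x: "\<And>i. i < s \<Longrightarrow> x i < x (Suc i)" "\<And>i. i \<le> s \<Longrightarrow> poly p (x i) = 0" and "0 < s"
  obtains z where "\<And>i. i < Suc s \<Longrightarrow> z i < z (Suc i)" "z 0 = x 0" "z (Suc s) = x s"
    "\<And>i. 0 < i \<Longrightarrow> i \<le> s \<Longrightarrow> poly (pderiv p) (z i) = 0"
proof -
  obtain y where y: "\<And>i. i < s \<Longrightarrow> x i < y i" "\<And>i. i < s \<Longrightarrow> y i < x (Suc i)"
    "\<And>i. i < s \<Longrightarrow> poly (pderiv p) (y i) = 0"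
    using Rolle_roots[where x = x and s = s, OF x(1) x(2)] by blast
  define z where "z i = (if i = 0 then x 0 else if i = Suc s then x s else y (i - 1))" for i
  have z: "z i < z (Suc i)" if "i < Suc s" for i
  proof (cases i)
    case 0
    then show ?thesis using y(1)[of 0] \<open>0 < s\<close> by (simp add: z_def)
  next
    case (Suc j)
    show ?thesis
    proof (cases "Suc j = s")
      case True
      then show ?thesis using Suc y(2)[of j] by (auto simp: z_def)
    next
      case False
      then show ?thesis using Suc that y(2)[of j] y(1)[of "Suc j"] by (simp add: z_def)
    qed
  qed
  show ?thesis
  proof (rule that[of z])
    show "poly (pderiv p) (z i) = 0" if "0 < i" "i \<le> s" for i
      using that y(3)[of "i - 1"] by (simp add: z_def)
  qed (use z \<open>0 < s\<close> in \<open>auto simp: z_def\<close>)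
qed

text \<open>Each derivative gains one interior zero by Rolle, while a factor \<open>x^2 - 1\<close>
  survives as long as \<open>j < k\<close> and keeps \<open>-1\<close> and \<open>1\<close> among
  the zeros.\<close>

lemma rodrigues_roots:
  assumes "j < k"
  shows "\<exists>x :: nat \<Rightarrow> real. (\<forall>i<Suc j. x i < x (Suc i)) \<and> x 0 = -1 \<and> x (Suc j) = 1 \<and>
    (\<forall>i\<le>Suc j. poly ((pderiv ^^ j) ([:-1, 0, 1:] ^ k)) (x i) = 0)"
  using assms
proof (induction j)
  case 0
  then show ?case by (intro exI[of _ "\<lambda>i. 2 * real i - 1"]) (auto simp: le_Suc_eq)
next
  case (Suc j)
  then obtain x :: "nat \<Rightarrow> real" where
    x: "\<And>i. i < Suc j \<Longrightarrow> x i < x (Suc i)" "x 0 = -1" "x (Suc j) = 1"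
    "\<And>i. i \<le> Suc j \<Longrightarrow> poly ((pderiv ^^ j) ([:-1, 0, 1:] ^ k)) (x i) = 0"
    by (metis Suc_lessD)
  obtain z where z: "\<And>i. i < Suc (Suc j) \<Longrightarrow> z i < z (Suc i)" "z 0 = x 0" "z (Suc (Suc j)) = x (Suc j)"
    "\<And>i. 0 < i \<Longrightarrow> i \<le> Suc j \<Longrightarrow> poly (pderiv ((pderiv ^^ j) ([:-1, 0, 1:] ^ k))) (z i) = 0"
    using Rolle_roots_endpoints[where x = x and s = "Suc j", OF x(1) x(4)] by blast
  have "[:-1, 0, 1:] dvd (pderiv ^^ Suc j) ([:-1, 0, 1 :: real:] ^ k)"
    using power_dvd_higher_pderiv[of "Suc j" k "[:-1, 0, 1:]"] Suc.prems
    by (meson dvd_power dvd_trans less_or_eq_imp_le zero_less_diff)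
  then have ends: "poly ((pderiv ^^ Suc j) ([:-1, 0, 1:] ^ k)) t = 0" if "t = 1 \<or> t = -1" for t :: real
    using that by (auto elim!: dvdE)
  have "poly ((pderiv ^^ Suc j) ([:-1, 0, 1:] ^ k)) (z i) = 0" if "i \<le> Suc (Suc j)" for i
  proof (cases "i = 0 \<or> i = Suc (Suc j)")
    case True
    then show ?thesis using ends z(2,3) x(2,3) by auto
  next
    case False
    then show ?thesis using z(4)[of i] that by simp
  qed
  then show ?case using z(1-3) x(2,3) by (intro exI[of _ z]) auto
qed

text \<open>From the \<open>p+1\<close> zeros after \<open>p-1\<close> derivatives, Rolle gives
  \<open>p\<close> zeros of \<open>L_p\<close> and, once more, \<open>p-1\<close> zeros of
  \<open>L_p'\<close> strictly between \<open>-1\<close> and \<open>1\<close>; the factor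
  \<open>1 - x^2\<close> supplies the end points.\<close>

lemma lgl_roots:
  assumes "1 \<le> p"
  shows "\<exists>x :: nat \<Rightarrow> real. (\<forall>i<p. x i < x (Suc i)) \<and> x 0 = -1 \<and> x p = 1 \<and>
    (\<forall>i\<le>p. poly ([:1, 0, -1:] * pderiv (legendre p)) (x i) = 0)"
proof -
  obtain q where q: "p = Suc q" using assms by (cases p) auto
  let ?w = "(pderiv ^^ q) ([:-1, 0, 1:] ^ p) :: real poly"
  obtain x :: "nat \<Rightarrow> real" where
    x: "\<And>i. i < p \<Longrightarrow> x i < x (Suc i)" "x 0 = -1" "x p = 1" "\<And>i. i \<le> p \<Longrightarrow> poly ?w (x i) = 0"
    using rodrigues_roots[of q p] q by auto
  obtain y where y: "\<And>i. i < p \<Longrightarrow> x i < y i" "\<And>i. i < p \<Longrightarrow> y i < x (Suc i)"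
    "\<And>i. i < p \<Longrightarrow> poly (pderiv ?w) (y i) = 0"
    using Rolle_roots[where x = x and s = p, OF x(1) x(4)] by blast
  have yy: "y i < y (Suc i)" if "i < q" for i
    using y(1)[of "Suc i"] y(2)[of i] that q by simp
  have L: "legendre p = Polynomial.smult (1 / (2 ^ p * fact p)) (pderiv ?w)"
    by (simp add: legendre_def q del: power_Suc)
  have root: "poly (legendre p) (y i) = 0" if "i \<le> q" for i
    using y(3)[of i] that q L by simp
  show ?thesis
  \<comment> \<open>For \<open>p = 1\<close> there is no gap between zeros of \<open>L_1\<close>,
    and the end points alone suffice.\<close>
  proof (cases "q = 0")
    case True
    then show ?thesis using q
      by (intro exI[of _ "\<lambda>i. 2 * real i - 1"]) (auto simp: le_Suc_eq)
  next
    case False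
    obtain v where v: "\<And>i. i < q \<Longrightarrow> y i < v i" "\<And>i. i < q \<Longrightarrow> v i < y (Suc i)"
      "\<And>i. i < q \<Longrightarrow> poly (pderiv (legendre p)) (v i) = 0"
      using Rolle_roots[where x = y and s = q, OF yy root] by blast
    define z where "z i = (if i = 0 then -1 else if i = p then 1 else v (i - 1))" for i
    have "z i < z (Suc i)" if "i < p" for i
    proof (cases i)
      case 0
      then show ?thesis using v(1)[of 0] y(1)[of 0] x(2) q False by (simp add: z_def)
    next
      case (Suc j)
      show ?thesis
      proof (cases "Suc j = q")
        case True
        then show ?thesis using Suc q v(2)[of j] y(2)[of q] x(3) by (auto simp: z_def)
      next
        case False
        then show ?thesis using Suc that q v(2)[of j] v(1)[of "Suc j"] by (simp add: z_def)
      qed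
    qed
    moreover have "poly ([:1, 0, -1:] * pderiv (legendre p)) (z i) = 0" if "i \<le> p" for i
      using that v(3)[of "i - 1"] q by (auto simp: z_def)
    ultimately show ?thesis using q by (intro exI[of _ z]) (auto simp: z_def)
  qed
qed

text \<open>The defining polynomial has degree at most \<open>p+1\<close>, so the \<open>p+1\<close>
  zeros already found are all of them, and the sorted list in \<open>lgl_node\<close> enumerates
  exactly these.\<close>

lemma lgl_node_properties:
  assumes p: "1 \<le> p"
  shows lgl_node_less: "i < j \<Longrightarrow> j \<le> p \<Longrightarrow> lgl_node p i < lgl_node p j"
    and lgl_node_0: "lgl_node p 0 = -1"
    and lgl_node_last: "lgl_node p p = 1"
    and lgl_node_root: "i \<le> p \<Longrightarrow> (1 - (lgl_node p i)\<^sup>2) * poly (pderiv (legendre p)) (lgl_node p i) = 0"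
proof -
  let ?Q = "[:1, 0, -1:] * pderiv (legendre p)"
  let ?S = "{x. poly ?Q x = 0}"
  obtain x :: "nat \<Rightarrow> real" where x: "\<And>i. i < p \<Longrightarrow> x i < x (Suc i)" "x 0 = -1" "x p = 1"
    "\<And>i. i \<le> p \<Longrightarrow> poly ?Q (x i) = 0"
    using lgl_roots[OF p] by blast
  have less: "x i < x j" if "i < j" "j \<le> p" for i j
    using that
  proof (induction j)
    case (Suc j)
    then show ?case using x(1)[of j] by (cases "i = j") (auto intro: less_trans)
  qed simp
  have dp: "pderiv (legendre p) \<noteq> 0"
    using p degree_legendre[of p] by (metis not_one_le_zero pderiv_eq_0_iff)
  have Q0: "?Q \<noteq> 0" unfolding mult_eq_0_iff using dp by simp
  have "degree ?Q = 2 + degree (pderiv (legendre p))"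
    using dp by (subst degree_mult_eq) simp_all
  then have dQ: "degree ?Q \<le> Suc p"
    using p by (simp add: degree_pderiv degree_legendre)
  have fin: "finite ?S" using poly_roots_finite[OF Q0] .
  have inj: "inj_on x {..p}"
    by (metis atMost_iff inj_onI less less_irrefl linorder_neqE_nat)
  have "card (x ` {..p}) = Suc p" using inj by (simp add: card_image)
  moreover have "card ?S \<le> Suc p" using card_poly_roots_bound[OF Q0] dQ by linarith
  ultimately have S: "x ` {..p} = ?S"
    using x(4) fin by (intro card_seteq) auto
  have "sorted_list_of_set ?S = map x [0..<Suc p]"
  proof (rule sorted_distinct_set_unique)
    show "set (sorted_list_of_set ?S) = set (map x [0..<Suc p])"
      unfolding set_sorted_list_of_set[OF fin] S[symmetric] by (auto simp del: upt_Suc)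
    show "sorted (map x [0..<Suc p])"
      unfolding sorted_iff_nth_mono_less using less by (auto simp del: upt_Suc intro: less_imp_le)
    show "distinct (map x [0..<Suc p])"
      using inj by (simp add: distinct_map atLeast0LessThan lessThan_Suc_atMost del: upt_Suc)
  qed simp_all
  then have node: "lgl_node p i = x i" if "i \<le> p" for i
    using that unfolding lgl_node_def by (simp del: upt_Suc)
  show "i < j \<Longrightarrow> j \<le> p \<Longrightarrow> lgl_node p i < lgl_node p j" using less node by simp
  show "lgl_node p 0 = -1" "lgl_node p p = 1" using node x by simp_all
  show "i \<le> p \<Longrightarrow> (1 - (lgl_node p i)\<^sup>2) * poly (pderiv (legendre p)) (lgl_node p i) = 0"
    using x(4)[of i] node[of i] by (auto simp: power2_eq_square algebra_simps)
qed

subsection \<open>Nodal vectors\<close>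

definition nodal :: "nat \<Rightarrow> real poly \<Rightarrow> real vec" where
  "nodal p q = vec (p + 1) (\<lambda>i. poly q (lgl_node p i))"

lemma nodal_carrier [simp]: "nodal p q \<in> carrier_vec (p + 1)"
  by (simp add: nodal_def)

lemma index_nodal [simp]: "i \<le> p \<Longrightarrow> nodal p q $ i = poly q (lgl_node p i)"
  by (simp add: nodal_def)

lemma dim_nodal [simp]: "dim_vec (nodal p q) = p + 1"
  by (simp add: nodal_def)

lemma lgl_node_inj:
  assumes "1 \<le> p" "i \<le> p" "j \<le> p"
  shows "lgl_node p i = lgl_node p j \<longleftrightarrow> i = j"
  using assms lgl_node_less[of p i j] lgl_node_less[of p j i] by (cases i j rule: linorder_cases) auto

lemma poly_eqI_lgl:
  assumes p: "1 \<le> p" and "degree a \<le> p" "degree b \<le> p"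
    and eq: "\<And>i. i \<le> p \<Longrightarrow> poly a (lgl_node p i) = poly b (lgl_node p i)"
  shows "a = b"
proof (rule poly_eqI_degree)
  have "card (lgl_node p ` {..p}) = Suc p"
    by (subst card_image) (auto simp: inj_on_def lgl_node_inj[OF p])
  then show "degree a < card (lgl_node p ` {..p})" "degree b < card (lgl_node p ` {..p})"
    using assms by simp_all
qed (use eq in auto)

lemma poly_lagrange_poly:
  assumes p: "1 \<le> p" "i \<le> p" "j \<le> p"
  shows "poly (lagrange_poly p j) (lgl_node p i) = (if i = j then 1 else 0)"
proof (cases "i = j")
  case True
  have "lgl_node p j - lgl_node p k \<noteq> 0" if "k \<in> {..p} - {j}" for k
    using lgl_node_inj[OF p(1,3), of k] that by auto
  then have "poly (lagrange_poly p j) (lgl_node p j) = (\<Prod>k\<in>{..p} - {j}. 1)"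
    unfolding lagrange_poly_def poly_prod by (intro prod.cong) (auto simp flip: diff_divide_distrib)
  then show ?thesis using True by simp
next
  case False
  then show ?thesis using p by (auto simp: lagrange_poly_def poly_prod intro!: prod_zero bexI[of _ i])
qed

lemma degree_lagrange_poly:
  assumes "j \<le> p"
  shows "degree (lagrange_poly p j) \<le> p"
proof -
  have "degree (lagrange_poly p j) \<le>
      sum (degree \<circ> (\<lambda>k. Polynomial.smult (1 / (lgl_node p j - lgl_node p k)) [:- lgl_node p k, 1:])) ({..p} - {j})"
    unfolding lagrange_poly_def by (rule degree_prod_sum_le) simp
  also have "\<dots> \<le> (\<Sum>k\<in>{..p} - {j}. 1)" by (rule sum_mono) simp
  also have "\<dots> = p" using assms by simp
  finally show ?thesis .
qed

lemma lagrange_interpolation: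
  assumes p: "1 \<le> p" and q: "degree q \<le> p"
  shows "q = (\<Sum>j\<le>p. Polynomial.smult (poly q (lgl_node p j)) (lagrange_poly p j))"
proof (rule poly_eqI_lgl[OF p q])
  show "degree (\<Sum>j\<le>p. Polynomial.smult (poly q (lgl_node p j)) (lagrange_poly p j)) \<le> p"
    by (rule degree_sum_le) (auto intro: order_trans[OF degree_smult_le] degree_lagrange_poly)
  fix i assume "i \<le> p"
  then show "poly q (lgl_node p i) =
      poly (\<Sum>j\<le>p. Polynomial.smult (poly q (lgl_node p j)) (lagrange_poly p j)) (lgl_node p i)"
    by (simp add: poly_sum poly_lagrange_poly[OF p] if_distrib[of "(*) _"] cong: if_cong)
qed

text \<open>Interpolation reproduces polynomials of degree at most \<open>p\<close>, so the matrix
  differentiates them exactly.\<close>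

lemma diff_mat_nodal:
  assumes p: "1 \<le> p" and q: "degree q \<le> p"
  shows "diff_mat p *\<^sub>v nodal p q = nodal p (pderiv q)"
proof (rule eq_vecI)
  fix i assume "i < dim_vec (nodal p (pderiv q))"
  then have i: "i \<le> p" by simp
  have "(diff_mat p *\<^sub>v nodal p q) $ i
      = (\<Sum>j\<le>p. poly (pderiv (lagrange_poly p j)) (lgl_node p i) * poly q (lgl_node p j))"
    using i by (simp add: diff_mat_def scalar_prod_def atLeast0LessThan lessThan_Suc_atMost nodal_def del: sum.lessThan_Suc)
  also have "\<dots> = poly (pderiv (\<Sum>j\<le>p. Polynomial.smult (poly q (lgl_node p j)) (lagrange_poly p j))) (lgl_node p i)"
    by (simp add: higher_pderiv_sum[of 1, simplified] pderiv_smult poly_sum mult.commute)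
  finally show "(diff_mat p *\<^sub>v nodal p q) $ i = nodal p (pderiv q) $ i"
    using i lagrange_interpolation[OF p q] by simp
qed (simp add: diff_mat_def)

subsection \<open>Legendre expansions and their truncation\<close>

text \<open>The coefficients form a function on all of \<open>nat\<close>, so truncation keeps
  \<open>c\<close> and only lowers the bound.\<close>

definition legendre_series :: "(nat \<Rightarrow> real) \<Rightarrow> nat \<Rightarrow> real poly" where
  "legendre_series c p = (\<Sum>j\<le>p. Polynomial.smult (c j) (legendre j))"

lemma smult_sum_right: "Polynomial.smult a (sum f A) = (\<Sum>x\<in>A. Polynomial.smult a (f x :: real poly))"
  by (rule poly_ext) (simp add: poly_sum sum_distrib_left)

lemma degree_legendre_series: "degree (legendre_series c p) \<le> p"
  unfolding legendre_series_def
  by (rule degree_sum_le) (auto intro: order_trans[OF degree_smult_le] simp: degree_legendre)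

text \<open>Coefficients are peeled off from the top, since only the last term reaches the top
  degree.\<close>

lemma legendre_series_eq_0D:
  assumes "legendre_series c p = 0" "j \<le> p"
  shows "c j = 0"
  using assms
proof (induction p arbitrary: j)
  case 0
  then show ?case by (simp add: legendre_series_def legendre_0)
next
  case (Suc p)
  have split: "legendre_series c (Suc p) = legendre_series c p + Polynomial.smult (c (Suc p)) (legendre (Suc p))"
    by (simp add: legendre_series_def)
  have "coeff (legendre_series c p) (Suc p) = 0"
    using degree_legendre_series[of c p] by (intro coeff_eq_0) simp
  then have "c (Suc p) * lead_coeff (legendre (Suc p)) = 0"
    using arg_cong[OF Suc.prems(1), of "\<lambda>q. coeff q (Suc p)"] split by (simp add: degree_legendre)
  then have "c (Suc p) = 0" using legendre_nonzero[of "Suc p"] by simp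
  then show ?case using Suc split by (cases "j = Suc p") auto
qed

section \<open>The Vandermonde matrix, its inverse and the projection\<close>

lemma vandermonde_carrier: "vandermonde p \<in> carrier_mat (p + 1) (p + 1)"
  by (simp add: vandermonde_def)

lemma vandermonde_mult_vec: "vandermonde p *\<^sub>v vec (p + 1) c = nodal p (legendre_series c p)"
  by (rule eq_vecI)
    (auto simp: vandermonde_def scalar_prod_def legendre_series_def poly_sum nodal_def mult.commute
      atLeast0LessThan lessThan_Suc_atMost simp del: sum.lessThan_Suc sum.atMost_Suc)

text \<open>A kernel vector would be a Legendre series of degree at most \<open>p\<close> vanishing
  at \<open>p+1\<close> nodes. This also justifies \<open>the\<close> in
  \<open>proj_mat\<close>.\<close>

lemma vandermonde_inverse:
  assumes p: "1 \<le> p"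
  obtains W where "mat_inverse (vandermonde p) = Some W" "vandermonde p * W = 1\<^sub>m (p + 1)"
    "W * vandermonde p = 1\<^sub>m (p + 1)" "W \<in> carrier_mat (p + 1) (p + 1)"
proof -
  note V = vandermonde_carrier[of p]
  have "det (vandermonde p) \<noteq> 0"
  proof
    assume "det (vandermonde p) = 0"
    then obtain v where v: "v \<in> carrier_vec (p + 1)" "v \<noteq> 0\<^sub>v (p + 1)"
      "vandermonde p *\<^sub>v v = 0\<^sub>v (p + 1)"
      using det_0_iff_vec_prod_zero_field[OF V] by blast
    have vv: "v = vec (p + 1) (\<lambda>i. v $ i)" using v(1) by auto
    have "nodal p (legendre_series (\<lambda>i. v $ i) p) = 0\<^sub>v (p + 1)"
      using v(3) vandermonde_mult_vec[of p "\<lambda>i. v $ i"] vv by simp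
    then have "poly (legendre_series (\<lambda>i. v $ i) p) (lgl_node p i) = 0" if "i \<le> p" for i
      using that by (metis index_nodal index_zero_vec(1) less_Suc_eq_le Suc_eq_plus1)
    then have "legendre_series (\<lambda>i. v $ i) p = 0"
      by (intro poly_eqI_lgl[OF p degree_legendre_series]) simp_all
    then have "v = 0\<^sub>v (p + 1)"
      using legendre_series_eq_0D[of "\<lambda>i. v $ i" p] v(1) by (intro eq_vecI) auto
    with v(2) show False ..
  qed
  then have "vandermonde p \<in> Units (ring_mat TYPE(real) (p + 1) ())"
    by (rule det_non_zero_imp_unit[OF V])
  then obtain W where W: "mat_inverse (vandermonde p) = Some W"
    using mat_inverse(1)[OF V, of "()"] by (cases "mat_inverse (vandermonde p)") auto
  then show ?thesis using that mat_inverse(2)[OF V W] by blast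
qed

text \<open>This lets an arbitrary flux vector be treated as a polynomial.\<close>

lemma nodal_legendre_series_surj:
  assumes p: "1 \<le> p" and v: "v \<in> carrier_vec (p + 1)"
  obtains c where "v = nodal p (legendre_series c p)"
proof -
  obtain W where W: "vandermonde p * W = 1\<^sub>m (p + 1)" "W \<in> carrier_mat (p + 1) (p + 1)"
    using vandermonde_inverse[OF p] by blast
  have "vec (p + 1) (\<lambda>i. (W *\<^sub>v v) $ i) = W *\<^sub>v v" using W(2) by auto
  then have "nodal p (legendre_series (\<lambda>i. (W *\<^sub>v v) $ i) p) = vandermonde p *\<^sub>v (W *\<^sub>v v)"
    using vandermonde_mult_vec[of p "\<lambda>i. (W *\<^sub>v v) $ i"] by simp
  also have "\<dots> = v"
    using assoc_mult_mat_vec[OF vandermonde_carrier W(2) v] W(1) v by simp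
  finally show ?thesis using that by metis
qed

lemma proj_mat_carrier: "proj_mat n m \<in> carrier_mat (n + 1) (m + 1)"
  unfolding proj_mat_def by (rule mult_carrier_mat[OF vandermonde_carrier]) simp

text \<open>The inverse Vandermonde matrix recovers \<open>c\<close>, and its first
  \<open>n+1\<close> rows give the coefficients up to degree \<open>n\<close>.\<close>

lemma proj_mat_nodal:
  assumes m: "1 \<le> m" and nm: "n \<le> m"
  shows "proj_mat n m *\<^sub>v nodal m (legendre_series c m) = nodal n (legendre_series c n)"
proof -
  obtain W where W: "mat_inverse (vandermonde m) = Some W"
    "W * vandermonde m = 1\<^sub>m (m + 1)" "W \<in> carrier_mat (m + 1) (m + 1)"
    using vandermonde_inverse[OF m] by blast
  let ?W = "mat (n + 1) (m + 1) (\<lambda>(i, j). W $$ (i, j))"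
  let ?v = "nodal m (legendre_series c m)"
  have "W *\<^sub>v ?v = (W * vandermonde m) *\<^sub>v vec (m + 1) c"
    unfolding vandermonde_mult_vec[symmetric]
    by (rule assoc_mult_mat_vec[OF W(3) vandermonde_carrier, symmetric]) simp
  then have Wv: "W *\<^sub>v ?v = vec (m + 1) c" using W(2) by simp
  have "?W *\<^sub>v ?v = vec (n + 1) c"
  proof (rule eq_vecI)
    fix i assume "i < dim_vec (vec (n + 1) c)"
    then have i: "i < n + 1" "i < m + 1" using nm by simp_all
    have "row ?W i = row W i" using i W(3) by (intro eq_vecI) auto
    then have "(?W *\<^sub>v ?v) $ i = (W *\<^sub>v ?v) $ i" using i W(3) by simp
    then show "(?W *\<^sub>v ?v) $ i = vec (n + 1) c $ i" unfolding Wv using i by simp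
  qed simp
  moreover have "proj_mat n m *\<^sub>v ?v = vandermonde n *\<^sub>v (?W *\<^sub>v ?v)"
    unfolding proj_mat_def W(1) option.sel
    by (rule assoc_mult_mat_vec[OF vandermonde_carrier mat_carrier nodal_carrier])
  ultimately show ?thesis by (simp only: vandermonde_mult_vec)
qed

text \<open>A relation avoids extracting coefficients from a polynomial; linearity follows by
  combining the witnesses \<open>c\<close>.\<close>

definition truncates_to :: "nat \<Rightarrow> nat \<Rightarrow> real poly \<Rightarrow> real poly \<Rightarrow> bool" where
  "truncates_to n m p q \<longleftrightarrow> (\<exists>c. p = legendre_series c m \<and> q = legendre_series c n)"

lemma proj_mat_truncates:
  "1 \<le> m \<Longrightarrow> n \<le> m \<Longrightarrow> truncates_to n m p q \<Longrightarrow> proj_mat n m *\<^sub>v nodal m p = nodal n q"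
  by (auto simp: truncates_to_def proj_mat_nodal)

lemma truncates_to_add:
  assumes "truncates_to n m p q" "truncates_to n m p' q'"
  shows "truncates_to n m (p + p') (q + q')"
proof -
  have "legendre_series c k + legendre_series d k = legendre_series (\<lambda>j. c j + d j) k" for c d k
    by (simp add: legendre_series_def smult_add_left sum.distrib)
  then show ?thesis using assms unfolding truncates_to_def by metis
qed

lemma truncates_to_smult:
  assumes "truncates_to n m p q"
  shows "truncates_to n m (Polynomial.smult a p) (Polynomial.smult a q)"
proof -
  have "Polynomial.smult a (legendre_series c k) = legendre_series (\<lambda>j. a * c j) k" for c k
    by (simp add: legendre_series_def smult_sum_right)
  then show ?thesis using assms unfolding truncates_to_def by metis
qed

lemma truncates_to_diff:
  "truncates_to n m p q \<Longrightarrow> truncates_to n m p' q' \<Longrightarrow> truncates_to n m (p - p') (q - q')"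
  using truncates_to_add[of n m p q, OF _ truncates_to_smult[of n m p' q' "-1"]] by simp

lemma truncates_to_legendre:
  assumes "k \<le> m" "n \<le> m"
  shows "truncates_to n m (legendre k) (if k \<le> n then legendre k else 0)"
proof -
  have "legendre_series (\<lambda>j. if j = k then 1 else 0) l = (if k \<le> l then legendre k else 0)" for l
  proof -
    have "legendre_series (\<lambda>j. if j = k then 1 else 0) l = (\<Sum>j\<le>l. if j = k then legendre k else 0)"
      unfolding legendre_series_def by (rule sum.cong) auto
    then show ?thesis by (simp add: sum.delta')
  qed
  then show ?thesis unfolding truncates_to_def using assms by metis
qed

text \<open>The truncated Legendre expansions of the Dirac masses at \<open>1\<close> and \<open>-1\<close>.\<close>
definition delta_right :: "nat \<Rightarrow> real poly" where
  "delta_right n = legendre_series (\<lambda>j. (2 * real j + 1) / 2) n"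

definition delta_left :: "nat \<Rightarrow> real poly" where
  "delta_left n = legendre_series (\<lambda>j. (2 * real j + 1) / 2 * (-1) ^ j) n"

lemma delta_right_eq:
  "delta_right n = Polynomial.smult (1 / 2) (pderiv (legendre (Suc n)) + pderiv (legendre n))"
  unfolding sum_legendre[symmetric] delta_right_def legendre_series_def
  by (simp add: smult_sum_right)

lemma delta_left_eq:
  "delta_left n = Polynomial.smult ((-1) ^ n / 2) (pderiv (legendre (Suc n)) - pderiv (legendre n))"
proof -
  have "delta_left n = Polynomial.smult (1 / 2)
      (\<Sum>k\<le>n. Polynomial.smult ((2 * real k + 1) * (-1) ^ k) (legendre k))"
    unfolding delta_left_def legendre_series_def by (simp add: smult_sum_right)
  then show ?thesis unfolding alternating_sum_legendre by simp
qed

text \<open>This form isolates \<open>(1 + x) L_n'\<close>, which vanishes at every LGL node of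
  order \<open>n\<close> except \<open>1\<close>.\<close>

lemma poly_delta_right:
  "poly (delta_right n) x
    = (1 + x) * poly (pderiv (legendre n)) x / 2 + (real n + 1) / 2 * poly (legendre n) x"
  by (simp add: delta_right_eq poly_pderiv_legendre_Suc algebra_simps add_divide_distrib)

lemma poly_delta_left:
  "poly (delta_left n) x
    = (-1) ^ n * ((x - 1) * poly (pderiv (legendre n)) x / 2 + (real n + 1) / 2 * poly (legendre n) x)"
  by (simp add: delta_left_eq poly_pderiv_legendre_Suc algebra_simps add_divide_distrib diff_divide_distrib)

section \<open>The lifting terms as nodal values of polynomials\<close>

lemma pderiv_legendre_at_1: "poly (pderiv (legendre k)) 1 = real k * (real k + 1) / 2"
proof (induction k)
  case (Suc k)
  then show ?case by (simp add: poly_pderiv_legendre_Suc legendre_at_1 field_simps)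
qed (simp add: legendre_0)

lemma pderiv_legendre_at_minus_1:
  "poly (pderiv (legendre k)) (-1) = (-1) ^ Suc k * (real k * (real k + 1) / 2)"
proof (induction k)
  case (Suc k)
  show ?case by (simp only: poly_pderiv_legendre_Suc legendre_at_minus_1 Suc) (simp add: field_simps)
qed (simp add: legendre_0)

lemma lgl_node_interior:
  assumes p: "1 \<le> p" and i: "0 < i" "i < p"
  shows "poly (pderiv (legendre p)) (lgl_node p i) = 0"
proof -
  have "-1 < lgl_node p i" "lgl_node p i < 1"
    using lgl_node_less[OF p, of 0 i] lgl_node_less[OF p, of i p] i lgl_node_0[OF p] lgl_node_last[OF p]
    by simp_all
  then have "1 - (lgl_node p i)\<^sup>2 \<noteq> 0" by (auto simp: power2_eq_1_iff)
  then show ?thesis using lgl_node_root[OF p, of i] i by simp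
qed

text \<open>At the node \<open>1\<close>, \<open>(1 + x) L_p' / 2\<close> equals
  \<open>p (p+1) / 2\<close>, the reciprocal of the end weight.\<close>

lemma delta_right_lgl_node:
  assumes p: "1 \<le> p" and i: "i \<le> p"
  shows "poly (delta_right p) (lgl_node p i)
    = b_right p $ i / lgl_weight p p + (real p + 1) / 2 * poly (legendre p) (lgl_node p i)"
proof -
  consider "i = 0" | "0 < i" "i < p" | "i = p" using i by linarith
  then show ?thesis
    using p by cases (auto simp: poly_delta_right lgl_node_interior lgl_node_0 lgl_node_last b_right_def
      lgl_weight_def legendre_at_1 pderiv_legendre_at_1)
qed

text \<open>The mirror image; the minus sign compensates the entry \<open>-1\<close> of
  \<open>b_left\<close>.\<close>

lemma delta_left_lgl_node:
  assumes p: "1 \<le> p" and i: "i \<le> p"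
  shows "poly (delta_left p) (lgl_node p i)
    = - b_left p $ i / lgl_weight p 0 + (real p + 1) / 2 * (-1) ^ p * poly (legendre p) (lgl_node p i)"
proof -
  consider "i = 0" | "0 < i" "i < p" | "i = p" using i by linarith
  then show ?thesis
    using p by cases (auto simp: poly_delta_left lgl_node_interior lgl_node_0 lgl_node_last b_left_def
      lgl_weight_def legendre_at_minus_1 pderiv_legendre_at_minus_1 power2_eq_square algebra_simps
      simp flip: power_add mult_2)
qed

text \<open>\<open>1 - (-1)^(k+j)\<close> selects the degrees of parity opposite to
  \<open>k\<close>. The cutoff \<open>j < k\<close> sits in the coefficients so that the same ones
  serve for every admissible length \<open>N\<close>.\<close>

lemma pderiv_legendre_eq_series:
  assumes "k \<le> Suc N"
  shows "pderiv (legendre k)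
    = legendre_series (\<lambda>j. if j < k then (2 * real j + 1) / 2 * (1 - (-1) ^ (k + j)) else 0) N"
proof (cases k)
  case 0
  then show ?thesis by (simp add: legendre_0 legendre_series_def)
next
  case (Suc q)
  have "legendre_series (\<lambda>j. if j < k then (2 * real j + 1) / 2 * (1 - (-1) ^ (k + j)) else 0) N
      = (\<Sum>j\<le>q. Polynomial.smult ((2 * real j + 1) / 2 * (1 - (-1) ^ (k + j))) (legendre j))"
    unfolding legendre_series_def using assms Suc
    by (intro sum.mono_neutral_cong_right) auto
  \<comment> \<open>The two closed forms add up to \<open>L_(q+1)'\<close>, as their
    \<open>L_q'\<close> parts cancel.\<close>
  also have "\<dots> = delta_right q + Polynomial.smult ((-1) ^ q) (delta_left q)"
    unfolding delta_right_def delta_left_def legendre_series_def smult_sum_right sum.distrib[symmetric]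
    by (rule sum.cong) (simp_all add: Suc power_add algebra_simps add_divide_distrib flip: smult_add_left)
  also have "\<dots> = pderiv (legendre k)"
    by (rule poly_ext) (simp add: delta_right_eq delta_left_eq Suc field_simps flip: power_add mult_2)
  finally show ?thesis by simp
qed

text \<open>For \<open>k \<le> n\<close> nothing is cut off. For \<open>k > n\<close> the cutoff
  \<open>j < k\<close> is vacuous on degrees up to \<open>n\<close>, and what remains of
  \<open>L_k'\<close> is \<open>delta_right n - (-1)^k delta_left n\<close>, weighted by the
  end-point values of \<open>L_k\<close>.\<close>

lemma truncates_to_pderiv_legendre:
  assumes "k \<le> m" "n < m" and T: "T = (if k \<le> n then legendre k else 0)"
  shows "truncates_to n m (pderiv (legendre k))
    (pderiv T + Polynomial.smult (poly (legendre k) 1 - poly T 1) (delta_right n)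
      - Polynomial.smult (poly (legendre k) (-1) - poly T (-1)) (delta_left n))"
proof -
  let ?d = "\<lambda>j. if j < k then (2 * real j + 1) / 2 * (1 - (-1) ^ (k + j)) else 0"
  have m: "pderiv (legendre k) = legendre_series ?d m"
    using assms by (intro pderiv_legendre_eq_series) simp
  show ?thesis
  proof (cases "k \<le> n")
    case True
    have "pderiv (legendre k) = legendre_series ?d n"
      using True by (intro pderiv_legendre_eq_series) simp
    then show ?thesis using m T True unfolding truncates_to_def by (intro exI[of _ ?d]) simp
  next
    case False
    have "legendre_series ?d n = delta_right n - Polynomial.smult ((-1) ^ k) (delta_left n)"
      unfolding delta_right_def delta_left_def legendre_series_def smult_sum_right sum_subtractf[symmetric]
      using False by (intro sum.cong) (simp_all add: power_add algebra_simps diff_divide_distrib flip: smult_diff_left)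
    then show ?thesis using m T False unfolding truncates_to_def
      by (intro exI[of _ ?d]) (simp add: legendre_at_1 legendre_at_minus_1)
  qed
qed

text \<open>The claim is linear in the pair \<open>F\<close>, \<open>G\<close>, so it reduces to
  single Legendre polynomials.\<close>

lemma truncates_to_pderiv:
  assumes "n < m" and "truncates_to n m F G"
  shows "truncates_to n m (pderiv F)
    (pderiv G + Polynomial.smult (poly F 1 - poly G 1) (delta_right n)
      - Polynomial.smult (poly F (-1) - poly G (-1)) (delta_left n))"
proof -
  define T where "T k = (if k \<le> n then legendre k else 0)" for k
  define E where "E F G = pderiv G + Polynomial.smult (poly F 1 - poly G 1) (delta_right n)
      - Polynomial.smult (poly F (-1) - poly G (-1)) (delta_left n)" for F G
  have E_add: "E (F + F') (G + G') = E F G + E F' G'" for F G F' G'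
    by (rule poly_ext) (simp add: E_def pderiv_add algebra_simps)
  have E_smult: "E (Polynomial.smult a F) (Polynomial.smult a G) = Polynomial.smult a (E F G)" for a F G
    by (rule poly_ext) (simp add: E_def pderiv_smult algebra_simps)
  obtain c where c: "F = legendre_series c m" "G = legendre_series c n"
    using assms(2) unfolding truncates_to_def by blast
  \<comment> \<open>Since \<open>T k = 0\<close> beyond \<open>n\<close>, both expansions run over
    the same indices and one induction treats them together.\<close>
  have G: "G = (\<Sum>k\<le>m. Polynomial.smult (c k) (T k))"
    unfolding c legendre_series_def using assms(1) by (intro sum.mono_neutral_cong_left) (auto simp: T_def)
  have "truncates_to n m (pderiv (\<Sum>k\<in>A. Polynomial.smult (c k) (legendre k)))
      (E (\<Sum>k\<in>A. Polynomial.smult (c k) (legendre k)) (\<Sum>k\<in>A. Polynomial.smult (c k) (T k)))"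
    if "finite A" "A \<subseteq> {..m}" for A
    using that
  proof (induction A)
    case empty
    show ?case unfolding truncates_to_def
      by (intro exI[of _ "\<lambda>_. 0"]) (simp add: E_def legendre_series_def)
  next
    case (insert k A)
    have "truncates_to n m (pderiv (legendre k)) (E (legendre k) (T k))"
      unfolding E_def using insert.prems assms(1) by (intro truncates_to_pderiv_legendre) (auto simp: T_def)
    then show ?case
      using insert by (simp add: pderiv_add pderiv_smult E_add E_smult truncates_to_add truncates_to_smult)
  qed
  from this[of "{..m}"] show ?thesis
    unfolding G c(1) E_def legendre_series_def by simp
qed

subsection \<open>The projected scheme\<close>

lemma dim_b_left [simp]: "dim_vec (b_left p) = p + 1"
  by (simp add: b_left_def)

lemma dim_b_right [simp]: "dim_vec (b_right p) = p + 1"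
  by (simp add: b_right_def)

lemma dim_row_diff_mat [simp]: "dim_row (diff_mat p) = p + 1"
  by (simp add: diff_mat_def)

lemma dgsem_lgl_iff:
  assumes "du \<in> carrier_vec (m + 1)"
  shows "dgsem_lgl m J fL fR g du \<longleftrightarrow>
    (\<forall>i\<le>m. J * du $ i + (fL - g $ 0) / lgl_weight m 0 * b_left m $ i
      + (fR - g $ m) / lgl_weight m m * b_right m $ i + (diff_mat m *\<^sub>v g) $ i = 0)"
  unfolding dgsem_lgl_def using assms
  by (auto simp: vec_eq_iff less_Suc_eq_le)

text \<open>The scheme solved for the time derivative; it yields the recovery map and the existence
  of time derivatives in the counterexample.\<close>

definition dgsem_rate :: "nat \<Rightarrow> real \<Rightarrow> real \<Rightarrow> real \<Rightarrow> real vec \<Rightarrow> real vec" where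
  "dgsem_rate m J fL fR g = vec (m + 1) (\<lambda>i.
    - ((fL - g $ 0) / lgl_weight m 0 * b_left m $ i + (fR - g $ m) / lgl_weight m m * b_right m $ i
      + (diff_mat m *\<^sub>v g) $ i) / J)"

lemma dgsem_rate_carrier [simp]: "dgsem_rate m J fL fR g \<in> carrier_vec (m + 1)"
  by (simp add: dgsem_rate_def)

lemma dgsem_lgl_iff_rate:
  assumes "du \<in> carrier_vec (m + 1)" and "J \<noteq> 0"
  shows "dgsem_lgl m J fL fR g du \<longleftrightarrow> du = dgsem_rate m J fL fR g"
proof -
  have eq: "J * x + a + b + c = 0 \<longleftrightarrow> x = - (a + b + c) / J" for x a b c :: real
    using assms(2) by (auto simp: field_simps)
  show ?thesis
    unfolding dgsem_lgl_iff[OF assms(1)] eq using assms(1)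
    by (auto simp: dgsem_rate_def vec_eq_iff less_Suc_eq_le)
qed

lemma projected_time_derivative:
  assumes n: "1 \<le> n" and nm: "n < m" and du: "du \<in> carrier_vec (m + 1)"
    and FG: "truncates_to n m F G"
    and scheme: "dgsem_lgl m J fL fR (nodal m F) du"
  shows "J \<cdot>\<^sub>v (proj_mat n m *\<^sub>v du) = nodal n
    (Polynomial.smult (fL - poly G (-1)) (delta_left n)
      - Polynomial.smult (fR - poly G 1) (delta_right n) - pderiv G)"
proof -
  have m: "1 \<le> m" using n nm by simp
  define QL where "QL = delta_left m - Polynomial.smult ((real m + 1) / 2 * (-1) ^ m) (legendre m)"
  define QR where "QR = delta_right m - Polynomial.smult ((real m + 1) / 2) (legendre m)"
  have QL: "truncates_to n m QL (delta_left n)" and QR: "truncates_to n m QR (delta_right n)"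
  proof -
    \<comment> \<open>The top mode \<open>L_m\<close> is lost because \<open>n < m\<close>.\<close>
    have *: "truncates_to n m (Polynomial.smult a (legendre m)) 0" for a
      using truncates_to_smult[OF truncates_to_legendre[of m m n], of a] nm by simp
    have "truncates_to n m (delta_left m) (delta_left n)"
      unfolding delta_left_def truncates_to_def by blast
    from truncates_to_diff[OF this *] show "truncates_to n m QL (delta_left n)"
      unfolding QL_def by simp
    have "truncates_to n m (delta_right m) (delta_right n)"
      unfolding delta_right_def truncates_to_def by blast
    from truncates_to_diff[OF this *] show "truncates_to n m QR (delta_right n)"
      unfolding QR_def by simp
  qed
  let ?H = "Polynomial.smult (fL - poly F (-1)) QL - Polynomial.smult (fR - poly F 1) QR - pderiv F"
  have degF: "degree F \<le> m" using FG degree_legendre_series unfolding truncates_to_def by blast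
  have "J \<cdot>\<^sub>v du = nodal m ?H"
  proof (rule eq_vecI)
    fix i assume "i < dim_vec (nodal m ?H)"
    then have i: "i \<le> m" by simp
    have "J * du $ i + (fL - poly F (-1)) / lgl_weight m 0 * b_left m $ i
      + (fR - poly F 1) / lgl_weight m m * b_right m $ i + poly (pderiv F) (lgl_node m i) = 0"
      using scheme i m unfolding dgsem_lgl_iff[OF du] diff_mat_nodal[OF m degF]
      by (simp add: lgl_node_0 lgl_node_last)
    moreover have "poly QL (lgl_node m i) = - b_left m $ i / lgl_weight m 0"
      "poly QR (lgl_node m i) = b_right m $ i / lgl_weight m m"
      using delta_left_lgl_node[OF m i] delta_right_lgl_node[OF m i] by (simp_all add: QL_def QR_def)
    ultimately show "(J \<cdot>\<^sub>v du) $ i = nodal m ?H $ i"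
      using i du by simp
  qed (use du in simp)
  then have "J \<cdot>\<^sub>v (proj_mat n m *\<^sub>v du) = proj_mat n m *\<^sub>v nodal m ?H"
    using mult_mat_vec[OF proj_mat_carrier du, of n J] by simp
  also have "\<dots> = nodal n (Polynomial.smult (fL - poly F (-1)) (delta_left n)
      - Polynomial.smult (fR - poly F 1) (delta_right n)
      - (pderiv G + Polynomial.smult (poly F 1 - poly G 1) (delta_right n)
      - Polynomial.smult (poly F (-1) - poly G (-1)) (delta_left n)))"
    using m nm FG QL QR
    by (intro proj_mat_truncates truncates_to_diff truncates_to_smult truncates_to_pderiv) simp_all
  \<comment> \<open>The end values of \<open>F\<close> cancel:
    \<open>(fR - F(1)) + (F(1) - G(1)) = fR - G(1)\<close>, and likewise on the left.\<close>
  finally show ?thesis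
    by (simp add: smult_diff_left algebra_simps)
qed

text \<open>At the order-\<open>n\<close> nodes the two deltas are the lifting terms of order
  \<open>n\<close> plus multiples of \<open>L_n\<close>; these multiples make up the extra
  bracket.\<close>

lemma projected_dgsem:
  assumes n: "1 \<le> n" and nm: "n < m" and du: "du \<in> carrier_vec (m + 1)" and g: "g \<in> carrier_vec (m + 1)"
    and scheme: "dgsem_lgl m J fL fR g du"
  shows "J \<cdot>\<^sub>v (proj_mat n m *\<^sub>v du)
    + ((fL - (proj_mat n m *\<^sub>v g) $ 0) / lgl_weight n 0) \<cdot>\<^sub>v b_left n
    + ((fR - (proj_mat n m *\<^sub>v g) $ n) / lgl_weight n n) \<cdot>\<^sub>v b_right n
    + diff_mat n *\<^sub>v (proj_mat n m *\<^sub>v g)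
    + ((real n + 1) / 2 * ((fR - (proj_mat n m *\<^sub>v g) $ n) - (-1) ^ n * (fL - (proj_mat n m *\<^sub>v g) $ 0)))
        \<cdot>\<^sub>v col (vandermonde n) n
    = 0\<^sub>v (n + 1)"
proof -
  have m: "1 \<le> m" using n nm by simp
  obtain c where c: "g = nodal m (legendre_series c m)"
    using nodal_legendre_series_surj[OF m g] by blast
  let ?G = "legendre_series c n"
  have FG: "truncates_to n m (legendre_series c m) ?G" unfolding truncates_to_def by blast
  have g': "proj_mat n m *\<^sub>v g = nodal n ?G"
    using proj_mat_nodal[OF m, of n c] nm c by simp
  have ends: "nodal n ?G $ 0 = poly ?G (-1)" "nodal n ?G $ n = poly ?G 1"
    using n by (simp_all add: lgl_node_0 lgl_node_last)
  show ?thesis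
    unfolding g' ends projected_time_derivative[OF n nm du FG scheme[unfolded c]]
      diff_mat_nodal[OF n degree_legendre_series]
  proof (rule eq_vecI, goal_cases)
    case (1 i)
    then have i: "i \<le> n" by simp
    have "col (vandermonde n) n $ i = poly (legendre n) (lgl_node n i)"
      using i by (simp add: vandermonde_def)
    then show ?case
      using i by (simp add: delta_left_lgl_node[OF n i] delta_right_lgl_node[OF n i] vandermonde_def)
        (simp add: algebra_simps add_divide_distrib diff_divide_distrib)
  qed (simp add: vandermonde_def)
qed

text \<open>Interior nodes are zeros of \<open>L_p'\<close>, and \<open>L_p\<close> has no double
  zero.\<close>

lemma legendre_lgl_node_nonzero:
  assumes p: "1 \<le> p" and i: "i \<le> p"
  shows "poly (legendre p) (lgl_node p i) \<noteq> 0"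
proof -
  consider "i = 0" | "0 < i" "i < p" | "i = p" using i by linarith
  then show ?thesis
    using p lgl_node_interior[OF p, of i] legendre_no_double_root[of p "lgl_node p i"]
    by cases (auto simp: lgl_node_0 lgl_node_last legendre_at_1 legendre_at_minus_1)
qed

text \<open>The states \<open>0\<close> and \<open>L\<^sub>m\<close> have the same projection \<open>0\<close>, but as \<open>L\<^sub>m\<close> vanishes at no LGL node, the
  flux \<open>x \<mapsto> [x \<noteq> 0]\<close> sends them to the constant flux vectors \<open>0\<close> and \<open>1\<close>.\<close>
lemma not_recoverable_from_projection:
  assumes n: "1 \<le> n" and nm: "n < m"
  shows "\<not> recoverable_from n m (\<lambda>f u. (f, proj_mat n m *\<^sub>v u))"
proof
  assume "recoverable_from n m (\<lambda>f u. (f, proj_mat n m *\<^sub>v u))"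
  then obtain R :: "real \<Rightarrow> real \<Rightarrow> real \<Rightarrow> (real \<Rightarrow> real) \<times> real vec \<Rightarrow> real vec" where
    R: "\<And>f J fL fR u du. u \<in> carrier_vec (m + 1) \<Longrightarrow> du \<in> carrier_vec (m + 1) \<Longrightarrow> 0 < J \<Longrightarrow>
      dgsem_lgl m J fL fR (map_vec f u) du \<Longrightarrow> proj_mat n m *\<^sub>v du = R J fL fR (f, proj_mat n m *\<^sub>v u)"
    unfolding recoverable_from_def by blast
  have m: "1 \<le> m" and nm': "n \<le> m" using n nm by simp_all
  define f :: "real \<Rightarrow> real" where "f x = (if x = 0 then 0 else 1)" for x
  have f1: "map_vec f (nodal m (legendre m)) = nodal m 1"
    using legendre_lgl_node_nonzero[OF m] by (intro eq_vecI) (auto simp: f_def less_Suc_eq_le)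
  have f0: "map_vec f (nodal m 0) = nodal m 0"
    by (intro eq_vecI) (auto simp: f_def less_Suc_eq_le)
  have t0: "truncates_to n m 0 0"
    unfolding truncates_to_def by (intro exI[of _ "\<lambda>_. 0"]) (simp add: legendre_series_def)
  have t1: "truncates_to n m 1 1"
    using truncates_to_legendre[of 0 m n] nm' by (simp add: legendre_0)
  have tL: "truncates_to n m (legendre m) 0"
    using truncates_to_legendre[of m m n] nm by simp
  define du where "du F = dgsem_rate m 1 0 0 (nodal m F)" for F
  have du: "du F \<in> carrier_vec (m + 1)" "dgsem_lgl m 1 0 0 (nodal m F) (du F)" for F
    unfolding du_def
    by (rule dgsem_rate_carrier, rule dgsem_lgl_iff_rate[THEN iffD2, OF dgsem_rate_carrier _ refl], simp)
  have "proj_mat n m *\<^sub>v du 1 = R 1 0 0 (f, proj_mat n m *\<^sub>v nodal m (legendre m))"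
    using du[of 1] by (intro R nodal_carrier) (simp_all add: f1)
  also have "proj_mat n m *\<^sub>v nodal m (legendre m) = proj_mat n m *\<^sub>v nodal m 0"
    using proj_mat_truncates[OF m nm'] t0 tL by metis
  also have "R 1 0 0 (f, proj_mat n m *\<^sub>v nodal m 0) = proj_mat n m *\<^sub>v du 0"
    using du[of 0] by (intro R[symmetric] nodal_carrier) (simp_all add: f0)
  finally have "1 \<cdot>\<^sub>v (proj_mat n m *\<^sub>v du 1) = 1 \<cdot>\<^sub>v (proj_mat n m *\<^sub>v du 0)" by simp
  \<comment> \<open>With zero numerical fluxes a constant flux acts only through the end-point
    terms.\<close>
  then have "nodal n (delta_right n - delta_left n) = nodal n 0"
    unfolding projected_time_derivative[OF n nm du(1) t1 du(2)] projected_time_derivative[OF n nm du(1) t0 du(2)]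
    by simp
  \<comment> \<open>At \<open>1\<close> the two values are \<open>(n+1)^2 / 2\<close> and
    \<open>(-1)^n (n+1) / 2\<close>, which differ for \<open>n \<ge> 1\<close>.\<close>
  from arg_cong[OF this, of "\<lambda>v. v $ n"] have "poly (delta_right n) 1 = poly (delta_left n) 1"
    using n by (simp add: lgl_node_last)
  then have "real n * (real n + 1) + (real n + 1) = (-1) ^ n * (real n + 1)"
    by (simp add: poly_delta_right poly_delta_left legendre_at_1 pderiv_legendre_at_1 field_simps)
  then have "(real n + 1 - (-1) ^ n) * (real n + 1) = 0" by (simp add: algebra_simps)
  moreover have "real n + 1 \<noteq> 0" by linarith
  ultimately have "real n + 1 = (-1) ^ n" by simp
  moreover have "(-1) ^ n \<le> (1 :: real)" by (cases "even n") simp_all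
  ultimately show False using n by simp
qed

theorem proposition4p9:
  fixes n m :: nat
  assumes "1 \<le> n" and "n < m"
  shows
    "(\<forall>(f :: real \<Rightarrow> real) (J :: real) (fL :: real) (fR :: real).
      \<forall>u \<in> carrier_vec (m + 1). \<forall>du \<in> carrier_vec (m + 1).
        0 < J \<longrightarrow> dgsem_lgl m J fL fR (map_vec f u) du \<longrightarrow>
        (let du_bar = proj_mat n m *\<^sub>v du;
             f_bar = proj_mat n m *\<^sub>v map_vec f u
         in J \<cdot>\<^sub>v du_bar
            + ((fL - f_bar $ 0) / lgl_weight n 0) \<cdot>\<^sub>v b_left n
            + ((fR - f_bar $ n) / lgl_weight n n) \<cdot>\<^sub>v b_right n
            + diff_mat n *\<^sub>v f_bar
            + ((real n + 1) / 2 * ((fR - f_bar $ n) - (-1) ^ n * (fL - f_bar $ 0)))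
                \<cdot>\<^sub>v col (vandermonde n) n
            = 0\<^sub>v (n + 1)))
     \<and> recoverable_from n m (\<lambda>f u. map_vec f u)
     \<and> \<not> recoverable_from n m (\<lambda>f u. (f, proj_mat n m *\<^sub>v u))"
proof (intro conjI allI ballI impI)
  fix f :: "real \<Rightarrow> real" and J fL fR :: real and u du :: "real vec"
  assume "u \<in> carrier_vec (m + 1)" "du \<in> carrier_vec (m + 1)" "dgsem_lgl m J fL fR (map_vec f u) du"
  then show "let du_bar = proj_mat n m *\<^sub>v du;
             f_bar = proj_mat n m *\<^sub>v map_vec f u
         in J \<cdot>\<^sub>v du_bar
            + ((fL - f_bar $ 0) / lgl_weight n 0) \<cdot>\<^sub>v b_left n
            + ((fR - f_bar $ n) / lgl_weight n n) \<cdot>\<^sub>v b_right n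
            + diff_mat n *\<^sub>v f_bar
            + ((real n + 1) / 2 * ((fR - f_bar $ n) - (-1) ^ n * (fL - f_bar $ 0)))
                \<cdot>\<^sub>v col (vandermonde n) n
            = 0\<^sub>v (n + 1)"
    unfolding Let_def using assms by (intro projected_dgsem) simp_all
next
  show "recoverable_from n m (\<lambda>f u. map_vec f u)"
    unfolding recoverable_from_def
    \<comment> \<open>Recovery solves the scheme for the time derivative and projects; positivity of
      \<open>J\<close> permits the division.\<close>
    by (intro exI[of _ "\<lambda>J fL fR g. proj_mat n m *\<^sub>v dgsem_rate m J fL fR g"])
      (auto simp: dgsem_lgl_iff_rate)
next
  show "\<not> recoverable_from n m (\<lambda>f u. (f, proj_mat n m *\<^sub>v u))"
    using assms by (rule not_recoverable_from_projection)
qed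

end
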